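(* Let $\mathcal H$ be a real or complex Hilbert space and let $T$ be a bounded operator on $\mathcal H$ with $T^2=T$ and $\|T\|>1$ (a skew projection). Let $P$ and $Q$ be the orthogonal projections of $\mathcal H$ onto $\operatorname{Ran}T$ and $\operatorname{Ker}T$, respectively, and let $H$ be the selfadjoint operator on $M$ associated with the pair $(P,Q)$ by Halmos' two projections theorem (see context). Then there exists a unit vector $v\in\mathcal H$ with $\|Tv\|=\|T\|$ if and only if $\min\sigma(H)$ is an eigenvalue of $H$.
   Context: Halmos' two projections theorem. For orthogonal projections $P,Q$ on a Hilbert space $\mathcal H$, put $M_{00}=\operatorname{Ran}P\cap\operatorname{Ran}Q$, $M_{01}=\operatorname{Ran}P\cap\operatorname{Ker}Q$, $M_{10}=\operatorname{Ker}P\cap\operatorname{Ran}Q$, $M_{11}=\operatorname{Ker}P\cap\operatorname{Ker}Q$, and let $M=\operatorname{Ran}P\ominus(M_{00}\oplus M_{01})$, $M'=\operatorname{Ker}P\ominus(M_{10}\oplus M_{11})$. Then $M$ and $M'$ have the same dimension and can be identified by a suitable unitary so that, with respect to $\mathcal H=M_{00}\oplus M_{01}\oplus M_{10}\oplus M_{11}\oplus M\oplus M$, $$P=I\oplus I\oplus0\oplus0\oplus\begin{bmatrix}I&0\\0&0\end{bmatrix},\qquad Q=I\oplus0\oplus I\oplus0\oplus\begin{bmatrix}I-H&\sqrt{H(I-H)}\\ \sqrt{H(I-H)}&H\end{bmatrix},$$ where $H$ is a selfadjoint operator on $M$ with $\sigma(H)\subseteq[0,1]$ such that neither $0$ nor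 $1$ is an eigenvalue of $H$. Thus $H$ is the compression of $I-Q$ to $M$. The space $M$ is $\{0\}$ if and only if $P$ and $Q$ commute; for $P,Q$ arising from $T$ with $\|T\|>1$ one has $M\neq\{0\}$. *)

theory Defs
  imports "HOL-Analysis.Analysis"
begin

(* Scalar fields: the instances are real and complex. Up to isomorphism there are no
   others: z + sconj z is real (expand |z + 1|^2), so every z is a root of a quadratic
   polynomial with real coefficients. *)

class real_or_complex = real_normed_field +
  fixes sconj :: "'a \<Rightarrow> 'a"
  assumes sconj_add: "sconj (x + y) = sconj x + sconj y"
    and sconj_mult: "sconj (x * y) = sconj x * sconj y"
    and sconj_scaleR_one: "sconj (r *\<^sub>R 1) = r *\<^sub>R 1"
    and mult_sconj_self: "x * sconj x = (norm x)\<^sup>2 *\<^sub>R 1"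

instantiation real :: real_or_complex
begin
definition sconj_real :: "real \<Rightarrow> real" where "sconj_real x = x"
instance by standard (simp_all add: sconj_real_def power2_eq_square)
end

instantiation complex :: real_or_complex
begin
definition sconj_complex :: "complex \<Rightarrow> complex" where "sconj_complex = cnj"
instance
  by standard (simp_all add: sconj_complex_def scaleR_conv_of_real flip: complex_norm_square)
end

(* Inner products are linear in the first argument. Completeness is part of the class banach. *)

locale hilbert_space = vector_space smul
  for smul :: "'k::real_or_complex \<Rightarrow> 'h::banach \<Rightarrow> 'h" +
  fixes ip :: "'h \<Rightarrow> 'h \<Rightarrow> 'k"
  assumes scale_of_real: "smul (of_real r) x = r *\<^sub>R x"
    and ip_add_left: "ip (x + y) z = ip x z + ip y z"
    and ip_scale_left: "ip (smul c x) y = c * ip x y"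
    and ip_commute: "ip y x = sconj (ip x y)"
    and ip_self: "ip x x = of_real ((norm x)\<^sup>2)"

definition orthogonal_projection_onto ::
    "('h::banach \<Rightarrow> 'h \<Rightarrow> 'k::real_or_complex) \<Rightarrow> 'h set \<Rightarrow> ('h \<Rightarrow> 'h) \<Rightarrow> bool" where
  "orthogonal_projection_onto ip V P \<longleftrightarrow> (\<forall>x. P x \<in> V \<and> (\<forall>y\<in>V. ip (x - P x) y = 0))"

(* Operators on a closed subspace M are functions on the whole type of which only the
   values on M matter. *)

definition linear_map_on ::
    "('k::real_or_complex \<Rightarrow> 'h::banach \<Rightarrow> 'h) \<Rightarrow> 'h set \<Rightarrow> ('h \<Rightarrow> 'h) \<Rightarrow> bool" where
  "linear_map_on smul M A \<longleftrightarrow>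
     (\<forall>x\<in>M. \<forall>y\<in>M. A (x + y) = A x + A y) \<and> (\<forall>c. \<forall>x\<in>M. A (smul c x) = smul c (A x))"

definition bounded_operator_on ::
    "('k::real_or_complex \<Rightarrow> 'h::banach \<Rightarrow> 'h) \<Rightarrow> 'h set \<Rightarrow> ('h \<Rightarrow> 'h) \<Rightarrow> bool" where
  "bounded_operator_on smul M A \<longleftrightarrow>
     A ` M \<subseteq> M \<and> linear_map_on smul M A \<and> (\<exists>K. \<forall>x\<in>M. norm (A x) \<le> norm x * K)"

definition selfadjoint_on ::
    "('k::real_or_complex \<Rightarrow> 'h::banach \<Rightarrow> 'h) \<Rightarrow> ('h \<Rightarrow> 'h \<Rightarrow> 'k) \<Rightarrow> 'h set \<Rightarrow> ('h \<Rightarrow> 'h) \<Rightarrow> bool"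
  where
  "selfadjoint_on smul ip M A \<longleftrightarrow>
     bounded_operator_on smul M A \<and> (\<forall>x\<in>M. \<forall>y\<in>M. ip (A x) y = ip x (A y))"

definition positive_on ::
    "('k::real_or_complex \<Rightarrow> 'h::banach \<Rightarrow> 'h) \<Rightarrow> ('h \<Rightarrow> 'h \<Rightarrow> 'k) \<Rightarrow> 'h set \<Rightarrow> ('h \<Rightarrow> 'h) \<Rightarrow> bool"
  where
  "positive_on smul ip M A \<longleftrightarrow>
     selfadjoint_on smul ip M A \<and> (\<forall>x\<in>M. \<exists>r\<ge>0. ip (A x) x = of_real r)"

definition positive_sqrt_on ::
    "('k::real_or_complex \<Rightarrow> 'h::banach \<Rightarrow> 'h) \<Rightarrow> ('h \<Rightarrow> 'h \<Rightarrow> 'k) \<Rightarrow> 'h set \<Rightarrow>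
      ('h \<Rightarrow> 'h) \<Rightarrow> ('h \<Rightarrow> 'h) \<Rightarrow> bool" where
  "positive_sqrt_on smul ip M A S \<longleftrightarrow> positive_on smul ip M S \<and> (\<forall>x\<in>M. S (S x) = A x)"

definition unitary_between ::
    "('k::real_or_complex \<Rightarrow> 'h::banach \<Rightarrow> 'h) \<Rightarrow> ('h \<Rightarrow> 'h \<Rightarrow> 'k) \<Rightarrow> 'h set \<Rightarrow> 'h set \<Rightarrow>
      ('h \<Rightarrow> 'h) \<Rightarrow> bool" where
  "unitary_between smul ip M N U \<longleftrightarrow>
     linear_map_on smul M U \<and> bij_betw U M N \<and> (\<forall>x\<in>M. \<forall>y\<in>M. ip (U x) (U y) = ip x y)"

definition eigenvalue_on ::
    "('k::real_or_complex \<Rightarrow> 'h::banach \<Rightarrow> 'h) \<Rightarrow> 'h set \<Rightarrow> ('h \<Rightarrow> 'h) \<Rightarrow> 'k \<Rightarrow> bool" where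
  "eigenvalue_on smul M A c \<longleftrightarrow> (\<exists>x\<in>M. x \<noteq> 0 \<and> A x = smul c x)"

definition spectrum_on ::
    "('k::real_or_complex \<Rightarrow> 'h::banach \<Rightarrow> 'h) \<Rightarrow> 'h set \<Rightarrow> ('h \<Rightarrow> 'h) \<Rightarrow> 'k set" where
  "spectrum_on smul M A =
     {c. \<nexists>B. bounded_operator_on smul M B \<and>
            (\<forall>x\<in>M. B (A x - smul c x) = x \<and> A (B x) - smul c (B x) = x)}"

definition is_min_spectrum_on ::
    "('k::real_or_complex \<Rightarrow> 'h::banach \<Rightarrow> 'h) \<Rightarrow> 'h set \<Rightarrow> ('h \<Rightarrow> 'h) \<Rightarrow> real \<Rightarrow> bool" where
  "is_min_spectrum_on smul M A m \<longleftrightarrow>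
     of_real m \<in> spectrum_on smul M A \<and>
     (\<forall>c\<in>spectrum_on smul M A. \<exists>r\<ge>m. c = of_real r)"

definition kernel :: "('h::banach \<Rightarrow> 'h) \<Rightarrow> 'h set" where
  "kernel A = {x. A x = 0}"

(* V \<ominus> (W1 \<oplus> W2) *)
definition ominus_sum ::
    "('h::banach \<Rightarrow> 'h \<Rightarrow> 'k::real_or_complex) \<Rightarrow> 'h set \<Rightarrow> 'h set \<Rightarrow> 'h set \<Rightarrow> 'h set" where
  "ominus_sum ip V W1 W2 = {x \<in> V. \<forall>a\<in>W1. \<forall>b\<in>W2. ip x (a + b) = 0}"

definition halmos_M ::
    "('h::banach \<Rightarrow> 'h \<Rightarrow> 'k::real_or_complex) \<Rightarrow> ('h \<Rightarrow> 'h) \<Rightarrow> ('h \<Rightarrow> 'h) \<Rightarrow> 'h set" where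
  "halmos_M ip P Q = ominus_sum ip (range P) (range P \<inter> range Q) (range P \<inter> kernel Q)"

definition halmos_M' ::
    "('h::banach \<Rightarrow> 'h \<Rightarrow> 'k::real_or_complex) \<Rightarrow> ('h \<Rightarrow> 'h) \<Rightarrow> ('h \<Rightarrow> 'h) \<Rightarrow> 'h set" where
  "halmos_M' ip P Q = ominus_sum ip (kernel P) (kernel P \<inter> range Q) (kernel P \<inter> kernel Q)"

(* H is the operator on M = halmos_M ip P Q in the two projections theorem for P, Q.
   U : M \<rightarrow> M' is the identifying unitary, S = sqrt (H (I - H)), and the vector with
   components (a, b, c, d, x, y) is a + b + c + d + x + U y. *)
definition halmos_operator ::
    "('k::real_or_complex \<Rightarrow> 'h::banach \<Rightarrow> 'h) \<Rightarrow> ('h \<Rightarrow> 'h \<Rightarrow> 'k) \<Rightarrow>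
      ('h \<Rightarrow> 'h) \<Rightarrow> ('h \<Rightarrow> 'h) \<Rightarrow> ('h \<Rightarrow> 'h) \<Rightarrow> bool" where
  "halmos_operator smul ip P Q H \<longleftrightarrow>
     (let M = halmos_M ip P Q; M' = halmos_M' ip P Q in
      selfadjoint_on smul ip M H \<and>
      spectrum_on smul M H \<subseteq> of_real ` {0..1} \<and>
      \<not> eigenvalue_on smul M H 0 \<and> \<not> eigenvalue_on smul M H 1 \<and>
      (\<exists>U S. unitary_between smul ip M M' U \<and>
         positive_sqrt_on smul ip M (\<lambda>x. H (x - H x)) S \<and>
         (\<forall>a \<in> range P \<inter> range Q. \<forall>b \<in> range P \<inter> kernel Q.
          \<forall>c \<in> kernel P \<inter> range Q. \<forall>d \<in> kernel P \<inter> kernel Q. \<forall>x\<in>M. \<forall>y\<in>M.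
            P (a + b + c + d + x + U y) = a + b + x \<and>
            Q (a + b + c + d + x + U y) = a + c + (x - H x + S y) + U (S x + H y))))"

(* H is determined on M: it is the compression of I - Q. *)
lemma halmos_operator_eq_compression:
  assumes hs: "hilbert_space smul ip"
    and V: "module.subspace smul V" and P: "orthogonal_projection_onto ip V P"
    and W: "module.subspace smul W" and Q: "orthogonal_projection_onto ip W Q"
    and H: "halmos_operator smul ip P Q H"
    and x: "x \<in> halmos_M ip P Q"
  shows "H x = P (x - Q x)"
proof -
  interpret hilbert_space smul ip by fact
  have ipneg: "ip (- w) v = - ip w v" for w v
    using ip_scale_left[of "-1" w v] by simp
  have ipdiff: "ip (w - u) v = ip w v - ip u v" for w u v
    using ip_add_left[of w "- u" v] ipneg[of u v] by simp
  have ip0: "ip 0 v = 0" for v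
    using ipdiff[of 0 0 v] by simp
  have diff: "R (u - v) = R u - R v"
    if Z: "subspace Z" and R: "orthogonal_projection_onto ip Z R" for Z R u v
  proof -
    let ?e = "R (u - v) - (R u - R v)"
    have RZ: "R w \<in> Z" and Ro: "y \<in> Z \<Longrightarrow> ip (w - R w) y = 0" for w y
      using R by (auto simp: orthogonal_projection_onto_def)
    have e: "?e \<in> Z" using Z RZ by (intro subspace_diff)
    have "ip ?e ?e = ip (u - R u) ?e - ip (v - R v) ?e - ip ((u - v) - R (u - v)) ?e"
      unfolding ipdiff[symmetric] by (simp add: algebra_simps)
    also have "\<dots> = 0" using Ro[OF e] by simp
    finally show ?thesis by (simp add: ip_self)
  qed
  have "P 0 = 0" "Q 0 = 0"
    using diff[OF V P, of 0 0] diff[OF W Q, of 0 0] by auto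
  then have mem: "0 \<in> range P" "0 \<in> range Q" "0 \<in> kernel P" "0 \<in> kernel Q"
    using rangeI[of P 0] rangeI[of Q 0] by (auto simp: kernel_def)
  let ?M = "halmos_M ip P Q"
  have M0: "0 \<in> ?M"
    using mem by (auto simp: halmos_M_def ominus_sum_def ip0)
  obtain U S where U: "unitary_between smul ip ?M (halmos_M' ip P Q) U"
    and S: "positive_sqrt_on smul ip ?M (\<lambda>x. H (x - H x)) S"
    and HM: "selfadjoint_on smul ip ?M H"
    and block: "\<forall>a \<in> range P \<inter> range Q. \<forall>b \<in> range P \<inter> kernel Q.
          \<forall>c \<in> kernel P \<inter> range Q. \<forall>d \<in> kernel P \<inter> kernel Q. \<forall>x\<in>?M. \<forall>y\<in>?M.
            P (a + b + c + d + x + U y) = a + b + x \<and>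
            Q (a + b + c + d + x + U y) = a + c + (x - H x + S y) + U (S x + H y)"
    using H unfolding halmos_operator_def Let_def by blast
  have lin0: "A 0 = 0" if "linear_map_on smul ?M A" for A
    using that M0 unfolding linear_map_on_def by (metis add_0 add_cancel_right_right)
  have z: "U 0 = 0" "S 0 = 0" "H 0 = 0"
    using U S HM lin0
    by (auto simp: unitary_between_def positive_sqrt_on_def positive_on_def selfadjoint_on_def
        bounded_operator_on_def)
  have ran: "H x \<in> ?M" "S x \<in> ?M"
    using S HM x
    by (auto simp: positive_sqrt_on_def positive_on_def selfadjoint_on_def bounded_operator_on_def)
  have block': "P (u + U y) = u \<and> Q (u + U y) = u - H u + S y + U (S u + H y)"
    if "u \<in> ?M" "y \<in> ?M" for u y
  proof -
    have "P (0 + 0 + 0 + 0 + u + U y) = 0 + 0 + u \<and>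
          Q (0 + 0 + 0 + 0 + u + U y) = 0 + 0 + (u - H u + S y) + U (S u + H y)"
      using block mem that by blast
    then show ?thesis by simp
  qed
  have "x - Q x = H x - U (S x)"
    using block'[OF x M0] z by simp
  also have "P \<dots> = P (H x) - P (U (S x))"
    by (rule diff[OF V P])
  also have "\<dots> = H x"
    using block'[OF ran(1) M0] block'[OF M0 ran(2)] z by simp
  finally show ?thesis ..
qed

end

theory Submission
  imports Defs
begin

text \<open>
  On \<open>Ran T\<close> let \<open>A\<close> be the compression of \<open>I - Q\<close> and put \<open>c = 1 / \<parallel>T\<parallel>\<^sup>2 < 1\<close>. Since \<open>p - Q p\<close>
  is the shortest vector that \<open>T\<close> maps to \<open>p\<close>, \<open>c\<close> is the infimum of \<open>\<langle>A p, p\<rangle> = \<parallel>p - Q p\<parallel>\<^sup>2\<close> over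
  the unit vectors of \<open>Ran T\<close>, and the norm of \<open>T\<close> is attained iff \<open>A p = c p\<close> for some \<open>p \<noteq> 0\<close>.
  The operator \<open>I - A\<close> maps \<open>Ran T\<close> into \<open>M\<close>, where \<open>A\<close> agrees with \<open>H\<close>, and \<open>c < 1\<close>; so this
  transports eigenvectors and approximate eigenvectors for \<open>c\<close> from \<open>Ran T\<close> to \<open>M\<close> without the
  orthogonal decomposition of \<open>Ran T\<close>. Hence \<open>c\<close> is the minimum of the spectrum of \<open>H\<close>.
\<close>

section \<open>Inner products and their real part\<close>

context hilbert_space
begin

lemma ip_add_right: "ip x (y + z) = ip x y + ip x z"
  by (metis ip_commute ip_add_left sconj_add)

lemma ip_scale_right: "ip x (smul c y) = sconj c * ip x y"
  by (metis ip_commute ip_scale_left sconj_mult)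

lemma ip_scaleR_left: "ip (r *\<^sub>R x) y = of_real r * ip x y"
  by (metis ip_scale_left scale_of_real)

lemma ip_scaleR_right: "ip x (r *\<^sub>R y) = of_real r * ip x y"
  by (metis ip_scale_right scale_of_real of_real_def sconj_scaleR_one)

lemma ip_minus_left: "ip (- x) y = - ip x y"
  using ip_scaleR_left[of "-1" x y] by simp

lemma ip_diff_left: "ip (x - y) z = ip x z - ip y z"
  using ip_add_left[of x "- y" z] by (simp add: ip_minus_left)

lemma ip_zero_left: "ip 0 x = 0"
  using ip_scaleR_left[of 0 x x] by simp

lemma ip_eq_zero_commute: "ip x y = 0 \<longleftrightarrow> ip y x = 0"
proof -
  have "sconj 0 = (0::'k)"
    using sconj_scaleR_one[of 0] by simp
  then show ?thesis by (metis ip_commute)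
qed

lemma ip_self_eq_zero: "ip x x = 0 \<longleftrightarrow> x = 0"
  by (simp add: ip_self)

text \<open>The real part of the inner product, defined by polarization because the class of scalar
  fields provides no real part.\<close>

definition re :: "'h \<Rightarrow> 'h \<Rightarrow> real" where
  "re x y = ((norm (x + y))\<^sup>2 - (norm x)\<^sup>2 - (norm y)\<^sup>2) / 2"

lemma of_real_re: "of_real (2 * re x y) = ip x y + ip y x"
proof -
  have "of_real (2 * re x y) = ip (x + y) (x + y) - ip x x - ip y y"
    by (simp add: re_def ip_self)
  also have "\<dots> = ip x y + ip y x"
    by (simp add: ip_add_left ip_add_right)
  finally show ?thesis .
qed

text \<open>Identities for \<open>re\<close> are proved inside the scalar field, where
  \<open>of_real\<close> is injective.\<close>

lemma re_eqI: "of_real (2 * a) = ip x y + ip y x \<Longrightarrow> re x y = a"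
  using of_real_re[of x y] by (metis mult_left_cancel of_real_eq_iff zero_neq_numeral)

lemma re_commute: "re x y = re y x"
  by (simp add: re_def add.commute)

lemma re_add_left: "re (x + y) z = re x z + re y z"
proof (rule re_eqI)
  have "of_real (2 * (re x z + re y z)) = (of_real (2 * re x z) + of_real (2 * re y z) :: 'k)"
    by (simp add: algebra_simps)
  then show "of_real (2 * (re x z + re y z)) = ip (x + y) z + ip z (x + y)"
    unfolding of_real_re by (simp add: ip_add_left ip_add_right)
qed

lemma re_scaleR_left: "re (r *\<^sub>R x) y = r * re x y"
proof (rule re_eqI)
  have "of_real (2 * (r * re x y)) = (of_real r * of_real (2 * re x y) :: 'k)"
    by simp
  then show "of_real (2 * (r * re x y)) = ip (r *\<^sub>R x) y + ip y (r *\<^sub>R x)"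
    unfolding of_real_re by (simp add: ip_scaleR_left ip_scaleR_right algebra_simps)
qed

lemma re_add_right: "re x (y + z) = re x y + re x z"
  by (metis re_commute re_add_left)

lemma re_scaleR_right: "re x (r *\<^sub>R y) = r * re x y"
  by (metis re_commute re_scaleR_left)

lemma re_diff_left: "re (x - y) z = re x z - re y z"
  using re_add_left[of x "- y" z] re_scaleR_left[of "-1" y z] by simp

lemma re_diff_right: "re x (y - z) = re x y - re x z"
  by (metis re_commute re_diff_left)

lemmas re_simps = re_add_left re_add_right re_diff_left re_diff_right
  re_scaleR_left re_scaleR_right

lemma re_self: "re x x = (norm x)\<^sup>2"
proof -
  have "norm (x + x) = 2 * norm x"
    by (metis norm_scaleR scaleR_2 abs_numeral)
  then show ?thesis by (simp add: re_def power_mult_distrib)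
qed

lemma re_eq_zero: "ip x y = 0 \<Longrightarrow> re x y = 0"
  using ip_eq_zero_commute[of x y] by (intro re_eqI) simp

text \<open>Cauchy-Schwarz: with \<open>re\<close> defined by polarization, this is the squared
  triangle inequality.\<close>

lemma re_le_norm_mult: "re x y \<le> norm x * norm y"
proof -
  have "(norm (x + y))\<^sup>2 \<le> (norm x + norm y)\<^sup>2"
    by (intro power_mono norm_triangle_ineq) simp
  then show ?thesis by (simp add: re_def power2_sum)
qed

lemma norm_diff_squared: "(norm (x - y))\<^sup>2 = (norm x)\<^sup>2 - 2 * re x y + (norm y)\<^sup>2"
  unfolding re_self[symmetric] using re_commute[of x y] by (simp add: re_simps)

section \<open>Coercive and positive operators on a real subspace\<close>

lemma coercive_bound:
  assumes "\<delta> > 0" and "\<delta> * (norm x)\<^sup>2 \<le> re y x"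
  shows "norm x \<le> norm y / \<delta>"
proof (cases "x = 0")
  case False
  have "\<delta> * norm x * norm x \<le> norm y * norm x"
    using assms(2) re_le_norm_mult[of y x] by (simp add: power2_eq_square mult.assoc)
  then show ?thesis using False assms(1) by (simp add: field_simps)
qed (use assms in simp)

text \<open>As in the Lax-Milgram theorem, for a suitable step \<open>t\<close> the map sending
  \<open>x\<close> to \<open>x - t (B x - y)\<close> is a contraction of \<open>V\<close>, and its
  fixed point solves the equation.\<close>

lemma coercive_solvable:
  assumes V: "complete V" "real_vector.subspace V"
    and B: "linear B" "B ` V \<subseteq> V"
    and \<delta>: "0 < \<delta>" "\<delta> \<le> K"
    and coercive: "\<And>x. x \<in> V \<Longrightarrow> \<delta> * (norm x)\<^sup>2 \<le> re (B x) x"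
    and bound: "\<And>x. x \<in> V \<Longrightarrow> norm (B x) \<le> K * norm x"
    and y: "y \<in> V"
  obtains x where "x \<in> V" "B x = y"
proof -
  \<comment> \<open>This \<open>t\<close> minimizes the squared contraction factor
    \<open>1 - 2 t \<delta> + t^2 K^2\<close>; the minimum is the square of \<open>q\<close>
    below.\<close>
  define t where "t = \<delta> / K\<^sup>2"
  define f where "f x = x - t *\<^sub>R (B x - y)" for x
  define q where "q = sqrt (1 - \<delta>\<^sup>2 / K\<^sup>2)"
  have K: "K > 0" using \<delta> by simp
  have t: "t > 0" using \<delta> K by (simp add: t_def)
  have le1: "\<delta>\<^sup>2 / K\<^sup>2 \<le> 1"
    using \<delta> K by (simp add: power_mono)
  have q: "0 \<le> q" "q < 1" "q\<^sup>2 = 1 - \<delta>\<^sup>2 / K\<^sup>2"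
    using le1 \<delta> K by (simp_all add: q_def)
  have fV: "f ` V \<subseteq> V"
    using B(2) y V(2) unfolding f_def
    by (auto intro!: real_vector.subspace_diff real_vector.subspace_scale)
  have "dist (f u) (f v) \<le> q * dist u v" if uv: "u \<in> V" "v \<in> V" for u v
  proof -
    let ?w = "u - v"
    have w: "?w \<in> V" using uv V(2) by (simp add: real_vector.subspace_diff)
    have "f u - f v = ?w - t *\<^sub>R B ?w"
      by (simp add: f_def linear_diff[OF B(1)] algebra_simps)
    then have "(norm (f u - f v))\<^sup>2 = (norm ?w)\<^sup>2 - 2 * t * re (B ?w) ?w + t\<^sup>2 * (norm (B ?w))\<^sup>2"
      by (simp add: norm_diff_squared re_scaleR_right re_commute[of ?w] power_mult_distrib)
    also have "\<dots> \<le> (norm ?w)\<^sup>2 - 2 * t * (\<delta> * (norm ?w)\<^sup>2) + t\<^sup>2 * (K * norm ?w)\<^sup>2"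
      using coercive[OF w] bound[OF w] t
      by (intro add_mono diff_mono mult_left_mono power_mono) auto
    also have "\<dots> = q\<^sup>2 * (norm ?w)\<^sup>2"
      using K unfolding q(3) by (simp add: t_def field_simps power2_eq_square)
    finally have "(dist (f u) (f v))\<^sup>2 \<le> (q * dist u v)\<^sup>2"
      by (simp add: dist_norm power_mult_distrib)
    then show ?thesis
      by (rule power2_le_imp_le) (simp add: q)
  qed
  then have "\<exists>!x\<in>V. f x = x"
    using y by (intro Banach_fix[OF V(1) _ q(1,2) fV]) auto
  then obtain x where x: "x \<in> V" "f x = x" by blast
  then have "B x = y" using t by (simp add: f_def)
  with x show ?thesis using that by blast
qed

text \<open>For a positive operator, small values of the quadratic form force small images: evaluate the
  form at \<open>x - B x\<close>.\<close>

lemma positive_form_bound: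
  assumes "linear B" and sym: "re (B (B x)) x = re (B x) (B x)"
    and pos: "0 \<le> re (B (x - B x)) (x - B x)"
    and le: "re (B (B x)) (B x) \<le> (norm (B x))\<^sup>2"
  shows "(norm (B x))\<^sup>2 \<le> re (B x) x"
  using sym pos le by (simp add: linear_diff[OF \<open>linear B\<close>] re_simps re_self)

section \<open>Orthogonal projections\<close>

lemma projection_unique:
  assumes V: "subspace V" and P: "orthogonal_projection_onto ip V P"
    and z: "z \<in> V" "\<And>y. y \<in> V \<Longrightarrow> ip (x - z) y = 0"
  shows "P x = z"
proof -
  have d: "z - P x \<in> V"
    using P z V by (auto simp: orthogonal_projection_onto_def intro: subspace_diff)
  have "ip (z - P x) (z - P x) = ip (x - P x) (z - P x) - ip (x - z) (z - P x)"
    unfolding ip_diff_left[symmetric] by simp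
  also have "\<dots> = 0"
    using P d z by (simp add: orthogonal_projection_onto_def)
  finally show ?thesis by (simp add: ip_self_eq_zero)
qed

context
  fixes V P
  assumes V: "subspace V" and P: "orthogonal_projection_onto ip V P"
begin

lemma projection_in: "P x \<in> V"
  using P by (simp add: orthogonal_projection_onto_def)

lemma projection_orthogonal: "y \<in> V \<Longrightarrow> ip (x - P x) y = 0"
  using P by (simp add: orthogonal_projection_onto_def)

lemma projection_fixes: "x \<in> V \<Longrightarrow> P x = x"
  by (rule projection_unique[OF V P]) (simp_all add: ip_zero_left)

lemma range_projection: "range P = V"
  using projection_in projection_fixes by (metis image_subset_iff rangeI subsetI subset_antisym)

lemma linear_projection: "linear P"
proof (rule linearI)
  fix x y r
  have "ip (x + y - (P x + P y)) z = ip (x - P x) z + ip (y - P y) z" for z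
    unfolding ip_add_left[symmetric] by (simp add: algebra_simps)
  then show "P (x + y) = P x + P y"
    by (intro projection_unique[OF V P] subspace_add[OF V] projection_in)
       (simp add: projection_orthogonal)
  have "ip (r *\<^sub>R x - r *\<^sub>R P x) z = of_real r * ip (x - P x) z" for z
    by (simp add: ip_scaleR_left flip: scaleR_diff_right)
  then show "P (r *\<^sub>R x) = r *\<^sub>R P x"
    unfolding scale_of_real[symmetric]
    by (intro projection_unique[OF V P] subspace_scale[OF V] projection_in)
       (simp add: projection_orthogonal scale_of_real)
qed

lemma re_projection: "y \<in> V \<Longrightarrow> re (P x) y = re x y"
  using re_eq_zero[OF projection_orthogonal[of y x]] by (simp add: re_diff_left)

lemma projection_pythagoras: "(norm x)\<^sup>2 = (norm (P x))\<^sup>2 + (norm (x - P x))\<^sup>2"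
  using re_projection[OF projection_in, of x x] norm_diff_squared[of x "P x"]
  by (simp add: re_self)

lemma norm_projection_le: "norm (P x) \<le> norm x" "norm (x - P x) \<le> norm x"
proof -
  show "norm (P x) \<le> norm x"
    by (rule power2_le_imp_le) (simp_all add: projection_pythagoras[of x])
  show "norm (x - P x) \<le> norm x"
    by (rule power2_le_imp_le) (simp_all add: projection_pythagoras[of x])
qed

text \<open>The existence of a projection onto \<open>V\<close> forces closedness: \<open>V\<close>
  is the fixed-point set of a continuous map.\<close>

lemma complete_projection_space: "complete V"
proof -
  have "bounded_linear P"
    using linear_projection norm_projection_le(1)
    by (intro bounded_linear_intro[where K = 1]) (auto simp: linear_add linear_scale)
  then have "closed {x. P x = x}"
    by (intro closed_Collect_eq continuous_intros linear_continuous_on)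
  moreover have "V = {x. P x = x}"
    using projection_in projection_fixes by (metis (mono_tags) Collect_cong Collect_mem_eq)
  ultimately show ?thesis by (simp add: complete_eq_closed)
qed

end

lemma subspace_real: "subspace V \<Longrightarrow> real_vector.subspace V"
  unfolding real_vector.subspace_def subspace_def by (metis scale_of_real)

end

section \<open>The compression of \<open>I - Q\<close> to the range of the skew projection\<close>

locale skew_projection = hilbert_space smul ip
  for smul :: "'k::real_or_complex \<Rightarrow> 'h::banach \<Rightarrow> 'h" and ip +
  fixes T P Q :: "'h \<Rightarrow> 'h"
  assumes linear_T: "Vector_Spaces.linear smul smul T" and bounded_T: "bounded_linear T"
    and idem: "T \<circ> T = T" and norm_T: "onorm T > 1"
    and P: "orthogonal_projection_onto ip (range T) P"
    and Q: "orthogonal_projection_onto ip (kernel T) Q"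
begin

lemma idem': "T (T x) = T x"
  using idem by (metis comp_apply)

lemma subspace_range: "subspace (range T)"
  by (rule module_hom.subspace_image[OF module_hom_linearI[OF linear_T] subspace_UNIV])

lemma subspace_kernel: "subspace (kernel T)"
  unfolding kernel_def by (rule module_hom.subspace_kernel[OF module_hom_linearI[OF linear_T]])

lemmas P_in = projection_in[OF subspace_range P]
  and P_fixes = projection_fixes[OF subspace_range P]
  and range_P = range_projection[OF subspace_range P]
  and linear_P = linear_projection[OF subspace_range P]
  and re_P = re_projection[OF subspace_range P]
  and norm_P_le = norm_projection_le(1)[OF subspace_range P]
  and P_orthogonal = projection_orthogonal[OF subspace_range P]
  and Q_in = projection_in[OF subspace_kernel Q]
  and Q_fixes = projection_fixes[OF subspace_kernel Q]
  and range_Q = range_projection[OF subspace_kernel Q]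
  and linear_Q = linear_projection[OF subspace_kernel Q]
  and norm_coQ_le = norm_projection_le(2)[OF subspace_kernel Q]
  and Q_orthogonal = projection_orthogonal[OF subspace_kernel Q]

lemma T_fixes: "x \<in> range T \<Longrightarrow> T x = x"
  using idem' by auto

lemma T_coQ: "p \<in> range T \<Longrightarrow> T (p - Q p) = p"
  using Q_in[of p] T_fixes[of p] bounded_T
  by (simp add: kernel_def linear_diff bounded_linear.linear)

text \<open>The vectors \<open>v\<close> and \<open>T v\<close> differ by an element of
  \<open>kernel T\<close>, so their components orthogonal to \<open>kernel T\<close> agree.\<close>

lemma coQ_T: "T v - Q (T v) = v - Q v"
proof -
  have "v - T v \<in> kernel T"
    using bounded_T by (simp add: kernel_def linear_diff bounded_linear.linear idem')
  then have "Q v - Q (T v) = v - T v"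
    using Q_fixes[of "v - T v"] by (simp add: linear_diff[OF linear_Q])
  then show ?thesis by (simp add: algebra_simps)
qed

definition A :: "'h \<Rightarrow> 'h" where
  "A x = P (x - Q x)"

definition c :: real where
  "c = 1 / (onorm T)\<^sup>2"

abbreviation M :: "'h set" where
  "M \<equiv> halmos_M ip P Q"

lemma linear_A: "linear A"
proof -
  have "linear (P \<circ> (\<lambda>x. x - Q x))"
    by (intro linear_compose[OF _ linear_P] linear_compose_sub linear_Q
        bounded_linear.linear[OF bounded_linear_ident])
  then show ?thesis by (simp add: A_def[abs_def] comp_def)
qed

lemma A_in: "A x \<in> range T"
  by (simp add: A_def P_in)

lemma norm_A_le: "norm (A x) \<le> norm x"
  unfolding A_def by (rule order_trans[OF norm_P_le norm_coQ_le])

lemma re_A: "y \<in> range T \<Longrightarrow> re (A x) y = re (x - Q x) (y - Q y)"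
  using re_eq_zero[OF Q_orthogonal[OF Q_in]] by (simp add: A_def re_P re_diff_right)

lemma re_A_self: "p \<in> range T \<Longrightarrow> re (A p) p = (norm (p - Q p))\<^sup>2"
  by (simp add: re_A re_self)

lemma A_symmetric: "x \<in> range T \<Longrightarrow> y \<in> range T \<Longrightarrow> re (A x) y = re x (A y)"
  using re_A[of y x] re_A[of x y] by (metis re_commute)

lemma c_bounds: "0 < c" "c < 1"
  using norm_T by (auto simp: c_def)

lemma onorm_eq: "onorm T = 1 / sqrt c"
  using norm_T by (simp add: c_def real_sqrt_divide)

lemma norm_T_le: "c * (norm (T v))\<^sup>2 \<le> (norm v)\<^sup>2"
proof -
  have "(norm (T v))\<^sup>2 \<le> (onorm T * norm v)\<^sup>2"
    by (intro power_mono onorm bounded_T) simp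
  then show ?thesis
    using norm_T by (simp add: c_def power_mult_distrib field_simps)
qed

text \<open>The norm bound for \<open>T\<close> is applied to \<open>p - Q p\<close>, which
  \<open>T\<close> maps to \<open>p\<close>.\<close>

lemma A_lower: "p \<in> range T \<Longrightarrow> c * (norm p)\<^sup>2 \<le> re (A p) p"
  using norm_T_le[of "p - Q p"] by (simp add: T_coQ re_A_self)

text \<open>By \<open>coQ_T\<close>, the form of \<open>A\<close> at \<open>T v\<close> is the
  squared norm of \<open>v - Q v\<close>, hence at most that of \<open>v\<close>. A lower bound
  \<open>d > c\<close> would therefore bound the norm of \<open>T\<close> by
  \<open>1 / sqrt d\<close>, which is too small.\<close>

lemma c_greatest:
  assumes "\<And>p. p \<in> range T \<Longrightarrow> d * (norm p)\<^sup>2 \<le> re (A p) p"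
  shows "d \<le> c"
proof (rule ccontr)
  assume "\<not> d \<le> c"
  then have dc: "c < d" "0 < d" using c_bounds by auto
  have "norm (T v) \<le> 1 / sqrt d * norm v" for v
  proof -
    have "d * (norm (T v))\<^sup>2 \<le> (norm (v - Q v))\<^sup>2"
      using assms[of "T v"] by (simp add: re_A_self coQ_T)
    also have "\<dots> \<le> (norm v)\<^sup>2"
      using norm_coQ_le by (simp add: power_mono)
    finally have "sqrt (d * (norm (T v))\<^sup>2) \<le> sqrt ((norm v)\<^sup>2)"
      by (rule real_sqrt_le_mono)
    then show ?thesis using dc by (simp add: real_sqrt_mult field_simps)
  qed
  then have "onorm T \<le> 1 / sqrt d"
    using dc by (intro onorm_bound) auto
  also have "\<dots> < 1 / sqrt c"
    using dc c_bounds by (simp add: frac_less2)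
  finally show False by (simp add: onorm_eq)
qed

text \<open>Near-minimizers of the form are approximate eigenvectors for \<open>c\<close>, and
  minimizers are exact ones. This is \<open>positive_form_bound\<close> for \<open>A - c\<close>,
  whose form is nonnegative on \<open>range T\<close> by \<open>A_lower\<close> and at most the
  squared norm because \<open>Q\<close> is a projection and \<open>c > 0\<close>.\<close>

lemma norm_A_minus_c:
  assumes p: "p \<in> range T"
  shows "(norm (A p - c *\<^sub>R p))\<^sup>2 \<le> re (A p) p - c * (norm p)\<^sup>2"
proof -
  define B where "B x = A x - c *\<^sub>R x" for x
  have lin: "linear B"
    unfolding B_def[abs_def]
    by (rule linearI) (simp_all add: linear_add[OF linear_A] linear_scale[OF linear_A] algebra_simps)
  have B_in: "B x \<in> range T" if "x \<in> range T" for x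
    using that subspace_real[OF subspace_range] A_in unfolding B_def
    by (intro real_vector.subspace_diff real_vector.subspace_scale) auto
  have form: "re (B x) x = re (A x) x - c * (norm x)\<^sup>2" for x
    by (simp add: B_def re_simps re_self)
  have sym: "re (B u) v = re u (B v)" if "u \<in> range T" "v \<in> range T" for u v
    by (simp add: B_def re_simps A_symmetric[OF that])
  have "(norm (B p))\<^sup>2 \<le> re (B p) p"
  proof (rule positive_form_bound[OF lin])
    show "re (B (B p)) p = re (B p) (B p)"
      by (rule sym[OF B_in[OF p] p])
    show "0 \<le> re (B (p - B p)) (p - B p)"
      using A_lower[of "p - B p"] B_in[OF p] p
        real_vector.subspace_diff[OF subspace_real[OF subspace_range]]
      by (simp add: form)
    have "(norm (B p - Q (B p)))\<^sup>2 \<le> (norm (B p))\<^sup>2"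
      using norm_coQ_le by (simp add: power_mono)
    moreover have "0 \<le> c * (norm (B p))\<^sup>2"
      using c_bounds by simp
    ultimately show "re (B (B p)) (B p) \<le> (norm (B p))\<^sup>2"
      unfolding form re_A_self[OF B_in[OF p]] by linarith
  qed
  then show ?thesis by (simp add: form) (simp add: B_def)
qed

text \<open>Since \<open>T\<close> is idempotent, \<open>range P \<inter> range Q\<close> is
  \<open>{0}\<close>; only the summand \<open>range P \<inter> kernel Q\<close> has to be split
  off.\<close>

lemma mem_M: "x \<in> M \<longleftrightarrow> x \<in> range T \<and> (\<forall>b\<in>range T \<inter> kernel Q. ip x b = 0)"
proof -
  have "range T \<inter> kernel T = {0}"
  proof
    show "range T \<inter> kernel T \<subseteq> {0}"
    proof
      fix x assume "x \<in> range T \<inter> kernel T"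
      then have "T x = x" "T x = 0" using T_fixes[of x] by (auto simp: kernel_def)
      then show "x \<in> {0}" by simp
    qed
  qed (use subspace_0[OF subspace_range] subspace_0[OF subspace_kernel] in simp)
  then show ?thesis
    by (simp add: halmos_M_def ominus_sum_def range_P range_Q)
qed

lemma subspace_M: "subspace M"
  by (rule subspaceI)
     (simp_all add: mem_M ip_zero_left ip_add_left ip_scale_left
        subspace_0[OF subspace_range] subspace_add[OF subspace_range]
        subspace_scale[OF subspace_range])

lemma M_subset: "x \<in> M \<Longrightarrow> x \<in> range T"
  by (simp add: mem_M)

text \<open>On \<open>range T\<close> the operator \<open>I - A\<close> equals \<open>P Q\<close>;
  moving both projections to the other side of the inner product kills it against every
  \<open>b\<close> in \<open>range T\<close> with \<open>Q b = 0\<close>.\<close>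

lemma I_minus_A_in_M:
  assumes "p \<in> range T"
  shows "p - A p \<in> M"
proof -
  have eq: "p - A p = P (Q p)"
    using assms by (simp add: A_def linear_diff[OF linear_P] P_fixes)
  have "ip (P (Q p)) b = 0" if b: "b \<in> range T" "Q b = 0" for b
  proof -
    have "ip (Q p) b = 0"
      using Q_orthogonal[OF Q_in, of b p] b ip_eq_zero_commute by simp
    then show ?thesis
      using P_orthogonal[OF b(1), of "Q p"] by (simp add: ip_diff_left)
  qed
  then show ?thesis
    by (simp add: mem_M eq P_in kernel_def)
qed

section \<open>The bottom of the spectrum of \<open>H\<close> and norm attainment\<close>

context
  fixes H
  assumes H: "halmos_operator smul ip P Q H"
begin

lemma H_eq_A: "x \<in> M \<Longrightarrow> H x = A x"
  unfolding A_def
  using halmos_operator_eq_compression[OF hilbert_space_axioms subspace_range P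
      subspace_kernel Q H] .

lemma H_bounded_operator: "bounded_operator_on smul M H"
  using H by (simp add: halmos_operator_def selfadjoint_on_def Let_def)

lemma H_in: "x \<in> M \<Longrightarrow> H x \<in> M"
  using H_bounded_operator by (auto simp: bounded_operator_on_def)

text \<open>A bounded inverse of \<open>H - c\<close> on \<open>M\<close> would bound
  \<open>A - c\<close> from below on all of \<open>range T\<close>. Then
  \<open>norm_A_minus_c\<close> would push the lower bound of the form strictly above
  \<open>c\<close>, against \<open>c_greatest\<close>.\<close>

lemma c_in_spectrum: "of_real c \<in> spectrum_on smul M H"
proof (rule ccontr)
  assume "of_real c \<notin> spectrum_on smul M H"
  then obtain B where B: "bounded_operator_on smul M B"
    and inv: "\<And>x. x \<in> M \<Longrightarrow> B (H x - c *\<^sub>R x) = x"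
    by (auto simp: spectrum_on_def scale_of_real)
  obtain K where K: "\<And>x. x \<in> M \<Longrightarrow> norm (B x) \<le> norm x * K"
    using B by (auto simp: bounded_operator_on_def)
  \<comment> \<open>The term \<open>2 * \<bar>K\<bar>\<close> will bound \<open>x = p - A p\<close>
    and the \<open>1\<close> accounts for \<open>w = A p - c p\<close>; the absolute value is taken
    because \<open>K\<close> has no prescribed sign.\<close>
  define L where "L = 2 * \<bar>K\<bar> + 1"
  have L: "L > 0" by (simp add: L_def)
  have bound: "(1 - c) * norm p \<le> L * norm (A p - c *\<^sub>R p)" if p: "p \<in> range T" for p
  proof -
    define x where "x = p - A p"
    define w where "w = A p - c *\<^sub>R p"
    have x: "x \<in> M" using I_minus_A_in_M[OF p] by (simp add: x_def)
    \<comment> \<open>\<open>I - A\<close> commutes with \<open>A - c\<close>, so the defect of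
      \<open>x\<close> is the image of the defect \<open>w\<close> of \<open>p\<close> under
      \<open>I - A\<close>.\<close>
    have Hx: "H x - c *\<^sub>R x = w - A w"
      by (simp add: H_eq_A[OF x])
         (simp add: x_def w_def linear_diff[OF linear_A] linear_scale[OF linear_A] algebra_simps)
    have "H x - c *\<^sub>R x \<in> M"
      using x H_in subspace_real[OF subspace_M]
      by (intro real_vector.subspace_diff real_vector.subspace_scale) auto
    then have "norm x \<le> norm (w - A w) * K"
      using K[of "H x - c *\<^sub>R x"] inv[OF x] Hx by simp
    also have "\<dots> \<le> norm (w - A w) * \<bar>K\<bar>"
      by (simp add: mult_left_mono)
    also have "\<dots> \<le> 2 * norm w * \<bar>K\<bar>"
      using norm_triangle_ineq4[of w "A w"] norm_A_le[of w] by (intro mult_right_mono) auto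
    finally have x_le: "norm x \<le> 2 * norm w * \<bar>K\<bar>" .
    \<comment> \<open>\<open>p\<close> is recovered from its image in \<open>M\<close> and its
      defect; here \<open>c < 1\<close> enters.\<close>
    have "(1 - c) *\<^sub>R p = x + w"
      by (simp add: x_def w_def algebra_simps)
    then have "(1 - c) * norm p \<le> norm x + norm w"
      using c_bounds norm_triangle_ineq[of x w] by (metis abs_of_pos diff_gt_0_iff_gt norm_scaleR)
    then show ?thesis
      using x_le by (simp add: L_def w_def algebra_simps)
  qed
  define \<epsilon> where "\<epsilon> = ((1 - c) / L)\<^sup>2"
  have "c + \<epsilon> \<le> c"
  proof (rule c_greatest)
    fix p assume p: "p \<in> range T"
    have "((1 - c) / L * norm p)\<^sup>2 \<le> (norm (A p - c *\<^sub>R p))\<^sup>2"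
    proof (rule power_mono)
      show "(1 - c) / L * norm p \<le> norm (A p - c *\<^sub>R p)"
        using bound[OF p] L by (simp add: field_simps)
    qed (use L c_bounds in simp)
    then show "(c + \<epsilon>) * (norm p)\<^sup>2 \<le> re (A p) p"
      using norm_A_minus_c[OF p] unfolding \<epsilon>_def power_mult_distrib distrib_right by linarith
  qed
  moreover have "\<epsilon> > 0"
    using c_bounds L by (simp add: \<epsilon>_def)
  ultimately show False by simp
qed

text \<open>On \<open>range T\<close> the operator \<open>A - r\<close> is coercive with constant
  \<open>c - r\<close>, so its equation is solved there first; the solution for a right-hand side in
  \<open>M\<close> then turns out to lie in \<open>M\<close>.\<close>

lemma resolvent_below_c:
  assumes r: "r < c"
  shows "of_real r \<notin> spectrum_on smul M H"
proof -
  define \<delta> where "\<delta> = c - r"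
  have \<delta>: "\<delta> > 0" using r by (simp add: \<delta>_def)
  define D where "D x = A x - r *\<^sub>R x" for x
  have lin: "linear D"
    unfolding D_def[abs_def]
    by (rule linearI) (simp_all add: linear_add[OF linear_A] linear_scale[OF linear_A] algebra_simps)
  have D_in: "D ` range T \<subseteq> range T"
    using subspace_real[OF subspace_range] A_in unfolding D_def
    by (blast intro: real_vector.subspace_diff real_vector.subspace_scale)
  have coercive: "\<delta> * (norm x)\<^sup>2 \<le> re (D x) x" if "x \<in> range T" for x
    using A_lower[OF that] by (simp add: D_def \<delta>_def re_simps re_self algebra_simps)
  have D_bound: "norm (D x) \<le> (1 + \<bar>r\<bar>) * norm x" for x
    using norm_triangle_ineq4[of "A x" "r *\<^sub>R x"] norm_A_le[of x]
    by (simp add: D_def algebra_simps)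
  have "\<exists>x\<in>M. D x = y" if y: "y \<in> M" for y
  proof -
    have "\<delta> \<le> 1 + \<bar>r\<bar>" using c_bounds by (simp add: \<delta>_def)
    from coercive_solvable[OF complete_projection_space[OF subspace_range P]
        subspace_real[OF subspace_range] lin D_in \<delta> this coercive D_bound M_subset[OF y]]
    obtain x where x: "x \<in> range T" "D x = y" .
    \<comment> \<open>The equation \<open>A x - r x = y\<close> is rearranged so that both summands
      on the right lie in \<open>M\<close>; division by \<open>1 - r > 0\<close> puts
      \<open>x\<close> itself there.\<close>
    have "(1 - r) *\<^sub>R x = (x - A x) + y"
      using x(2) by (simp add: D_def algebra_simps)
    also have "\<dots> \<in> M"
      by (rule subspace_add[OF subspace_M I_minus_A_in_M[OF x(1)] y])
    finally have "(1 / (1 - r)) *\<^sub>R ((1 - r) *\<^sub>R x) \<in> M"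
      by (rule real_vector.subspace_scale[OF subspace_real[OF subspace_M]])
    then have "x \<in> M" using r c_bounds by simp
    then show ?thesis using x(2) by blast
  qed
  then obtain B where B: "\<And>y. y \<in> M \<Longrightarrow> B y \<in> M" "\<And>y. y \<in> M \<Longrightarrow> D (B y) = y"
    by metis
  have inj: "u = v" if "u \<in> M" "v \<in> M" "D u = D v" for u v
    using coercive_bound[OF \<delta> coercive, of "u - v"] that M_subset
      real_vector.subspace_diff[OF subspace_real[OF subspace_range]]
    by (simp add: linear_diff[OF lin])
  have D_eq: "D x = H x - smul (of_real r) x" if "x \<in> M" for x
    using that by (simp add: D_def H_eq_A scale_of_real)
  have D_M: "D x \<in> M" if "x \<in> M" for x
    unfolding D_eq[OF that] using that H_in subspace_M by (blast intro: subspace_diff subspace_scale)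
  have D_smul: "D (smul k x) = smul k (D x)" if "x \<in> M" for k x
    using that H_bounded_operator subspace_scale[OF subspace_M that]
    by (simp add: D_eq bounded_operator_on_def linear_map_on_def scale_right_diff_distrib
        scale_left_commute)
  \<comment> \<open>\<open>B\<close> only chooses solutions; its linearity comes from injectivity of
    \<open>D\<close> on \<open>M\<close>, its bound from coercivity.\<close>
  have "bounded_operator_on smul M B"
    unfolding bounded_operator_on_def linear_map_on_def
  proof (intro conjI ballI allI exI)
    show "B ` M \<subseteq> M" using B by blast
  next
    fix x y assume xy: "x \<in> M" "y \<in> M"
    show "B (x + y) = B x + B y"
      by (rule inj) (simp_all add: xy B subspace_add[OF subspace_M] linear_add[OF lin])
  next
    fix k x assume x: "x \<in> M"
    show "B (smul k x) = smul k (B x)"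
      by (rule inj) (simp_all add: x B subspace_scale[OF subspace_M] D_smul)
  next
    fix x assume "x \<in> M"
    then show "norm (B x) \<le> norm x * (1 / \<delta>)"
      using coercive_bound[OF \<delta> coercive[OF M_subset[OF B(1)]]] by (simp add: B(2))
  qed
  moreover have "B (H x - smul (of_real r) x) = x \<and> H (B x) - smul (of_real r) (B x) = x"
    if x: "x \<in> M" for x
    using inj[OF B(1)[OF D_M[OF x]] x B(2)[OF D_M[OF x]]] B(2)[OF x]
    unfolding D_eq[OF x] D_eq[OF B(1)[OF x]] by simp
  ultimately show ?thesis
    unfolding spectrum_on_def by blast
qed

text \<open>\<open>c\<close> is a spectral point and no real number below it is one; that the
  spectrum is real is part of \<open>halmos_operator\<close>.\<close>

lemma min_spectrum_iff: "is_min_spectrum_on smul M H m \<longleftrightarrow> m = c"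
proof
  assume "is_min_spectrum_on smul M H m"
  then have "of_real m \<in> spectrum_on smul M H" "m \<le> c"
    using c_in_spectrum by (auto simp: is_min_spectrum_on_def)
  then show "m = c"
    using resolvent_below_c[of m] by fastforce
next
  assume m: "m = c"
  have "spectrum_on smul M H \<subseteq> of_real ` {0..1}"
    using H by (simp add: halmos_operator_def Let_def)
  then show "is_min_spectrum_on smul M H m"
    using c_in_spectrum resolvent_below_c unfolding is_min_spectrum_on_def m
    by (metis (no_types, opaque_lifting) imageE in_mono linorder_not_less)
qed

text \<open>If \<open>v\<close> attains the norm, \<open>T v\<close> minimizes the form and is thus
  an eigenvector of \<open>A\<close>. Conversely, for an eigenvector \<open>x\<close> the vector
  \<open>x - Q x\<close> attains the norm after normalization.\<close>

lemma norm_attained_iff: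
  "(\<exists>v. norm v = 1 \<and> norm (T v) = onorm T) \<longleftrightarrow> eigenvalue_on smul M H (of_real c)"
proof
  assume "\<exists>v. norm v = 1 \<and> norm (T v) = onorm T"
  then obtain v where v: "norm v = 1" "norm (T v) = onorm T" by blast
  define p where "p = T v"
  have p: "p \<in> range T" by (simp add: p_def)
  have "re (A p) p \<le> 1"
    using norm_coQ_le[of v] v by (simp add: re_A_self[OF p]) (simp add: p_def coQ_T power_le_one)
  \<comment> \<open>The norm of \<open>p\<close> is \<open>onorm T\<close>, so \<open>c\<close> is
    exactly the reciprocal of its square.\<close>
  also have "1 = c * (norm p)\<^sup>2"
    using v norm_T by (simp add: p_def c_def)
  finally have "(norm (A p - c *\<^sub>R p))\<^sup>2 \<le> 0"
    using norm_A_minus_c[OF p] by linarith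
  then have Ap: "A p = c *\<^sub>R p" by simp
  \<comment> \<open>For an eigenvector, \<open>I - A\<close> acts as the nonzero factor
    \<open>1 - c\<close>, so \<open>p\<close> already lies in \<open>M\<close>.\<close>
  have "(1 / (1 - c)) *\<^sub>R (p - A p) \<in> M"
    using I_minus_A_in_M[OF p] subspace_real[OF subspace_M] by (simp add: real_vector.subspace_scale)
  moreover have "p - A p = (1 - c) *\<^sub>R p"
    by (simp add: Ap algebra_simps)
  ultimately have "p \<in> M" using c_bounds by simp
  moreover have "p \<noteq> 0" using v norm_T by (auto simp: p_def)
  ultimately show "eigenvalue_on smul M H (of_real c)"
    using Ap by (auto simp: eigenvalue_on_def H_eq_A scale_of_real)
next
  assume "eigenvalue_on smul M H (of_real c)"
  then obtain x where x: "x \<in> M" "x \<noteq> 0" "A x = c *\<^sub>R x"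
    by (auto simp: eigenvalue_on_def H_eq_A scale_of_real)
  define u where "u = x - Q x"
  have Tu: "T u = x" using T_coQ M_subset x by (simp add: u_def)
  have "(norm u)\<^sup>2 = c * (norm x)\<^sup>2"
    using re_A_self[OF M_subset[OF x(1)]] x by (simp add: u_def re_scaleR_left re_self)
  then have nu: "norm u = sqrt c * norm x"
    by (metis norm_ge_zero real_sqrt_mult real_sqrt_unique)
  then have pos: "norm u > 0" using c_bounds x by simp
  define v where "v = (1 / norm u) *\<^sub>R u"
  have "norm v = 1" using pos by (simp add: v_def)
  moreover have "T v = (1 / norm u) *\<^sub>R x"
    using bounded_T by (simp add: v_def linear_scale bounded_linear.linear Tu)
  then have "norm (T v) = onorm T"
    using x c_bounds by (simp add: nu onorm_eq)
  ultimately show "\<exists>v. norm v = 1 \<and> norm (T v) = onorm T" by blast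
qed

end

end

theorem corollary4:
  fixes smul :: "'k::real_or_complex \<Rightarrow> 'h::banach \<Rightarrow> 'h"
    and ip :: "'h \<Rightarrow> 'h \<Rightarrow> 'k"
    and T P Q H :: "'h \<Rightarrow> 'h"
  assumes "hilbert_space smul ip"
    and "Vector_Spaces.linear smul smul T" and "bounded_linear T"
    and "T \<circ> T = T" and "onorm T > 1"
    and "orthogonal_projection_onto ip (range T) P"
    and "orthogonal_projection_onto ip (kernel T) Q"
    and "halmos_operator smul ip P Q H"
  shows "(\<exists>v. norm v = 1 \<and> norm (T v) = onorm T) \<longleftrightarrow>
    (\<exists>m. is_min_spectrum_on smul (halmos_M ip P Q) H m \<and>
         eigenvalue_on smul (halmos_M ip P Q) H (of_real m))"
proof -
  interpret skew_projection smul ip T P Q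
    using assms by (intro skew_projection.intro skew_projection_axioms.intro)
  show ?thesis
    using min_spectrum_iff[OF assms(8)] norm_attained_iff[OF assms(8)] by simp
qed

end
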